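(* Let $X^*\in\mathbb{R}^{m\times p}$ and $\mathcal{T}_*:=\{i\in\{1,\dots,n\} : 1+\langle A_i,X^*\rangle=0\}$. Suppose that the only vector $z=(z_i)_{i\in\mathcal{T}_*}\in\mathbb{R}^{|\mathcal{T}_*|}$ with $z\ge 0$ and $\sum_{i\in\mathcal{T}_*}z_iA_i=0$ is $z=0$. Let $$\mathcal{C}:=\{D\in\mathbb{R}^{m\times p} : \langle D,A_i\rangle\le 0 \text{ for } i\in\mathcal{T}_*;\ \langle D,A_i\rangle\in\mathbb{R}\text{ for } i\notin\mathcal{T}_*\}.$$ Then the following assertions hold. (i) If $X^*$ is a local minimizer of problem (P), then $\langle\nabla f(X^* ),D\rangle\ge 0$ for all $D\in\mathcal{C}$. (ii) If $\langle\nabla f(X^* ),D\rangle>0$ for all $D\in\mathcal{C}\setminus\{0\}$, then $X^*$ is a local minimizer of problem (P).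
   Context: Let $m,p,n$ be positive integers. $\mathbb{R}^{m\times p}$ carries the inner product $\langle X,Y\rangle=\mathrm{tr}(X^TY)$ and the Frobenius norm $\|\cdot\|_F$. Let $f:\mathbb{R}^{m\times p}\to\mathbb{R}$ be twice continuously differentiable, $\lambda>0$, and $A_1,\dots,A_n\in\mathbb{R}^{m\times p}$. The 0-1 loss is $\ell_{0/1}(t)=1$ if $t>0$ and $\ell_{0/1}(t)=0$ if $t\le 0$. Problem (P) is $$\min_{X\in\mathbb{R}^{m\times p}}\ f(X)+\lambda\sum_{i=1}^n\ell_{0/1}(1+\langle A_i,X\rangle).$$ *)

theory Defs
  imports "HOL-Analysis.Analysis"
begin

text \<open>
  Matrices of size \<open>m \<times> p\<close> are elements of \<open>real^'p^'m\<close>. The library's inner product and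
  norm on this type are the trace inner product and the Frobenius norm:
\<close>

lemma inner_matrix_eq_trace:
  fixes X Y :: "real^'p^'m"
  shows "X \<bullet> Y = trace (transpose X ** Y)"
  unfolding inner_vec_def trace_def transpose_def matrix_matrix_mult_def
  by (simp, rule sum.swap)

lemma norm_matrix_eq_frobenius:
  fixes X :: "real^'p^'m"
  shows "norm X = sqrt (trace (transpose X ** X))"
  by (simp add: norm_eq_sqrt_inner inner_matrix_eq_trace)

definition twice_cont_diff :: "('a::real_normed_vector \<Rightarrow> real) \<Rightarrow> bool" where
  "twice_cont_diff f \<longleftrightarrow>
     (\<exists>(f' :: 'a \<Rightarrow> 'a \<Rightarrow>\<^sub>L real) (f'' :: 'a \<Rightarrow> 'a \<Rightarrow>\<^sub>L ('a \<Rightarrow>\<^sub>L real)).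
        (\<forall>X. (f has_derivative blinfun_apply (f' X)) (at X)) \<and>
        (\<forall>X. (f' has_derivative blinfun_apply (f'' X)) (at X)) \<and>
        continuous_on UNIV f'')"

definition gradient :: "('a::real_inner \<Rightarrow> real) \<Rightarrow> 'a \<Rightarrow> 'a" where
  "gradient f X = (THE G. GDERIV f X :> G)"

definition local_minimizer :: "('a::real_normed_vector \<Rightarrow> real) \<Rightarrow> 'a \<Rightarrow> bool" where
  "local_minimizer F X \<longleftrightarrow> (\<exists>\<epsilon>>0. \<forall>Y. norm (Y - X) < \<epsilon> \<longrightarrow> F X \<le> F Y)"

definition loss01 :: "real \<Rightarrow> real" where
  "loss01 t = (if t > 0 then 1 else 0)"

definition objective ::
  "(real^'p^'m \<Rightarrow> real) \<Rightarrow> real \<Rightarrow> nat \<Rightarrow> (nat \<Rightarrow> real^'p^'m) \<Rightarrow> real^'p^'m \<Rightarrow> real" where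
  "objective f lam n A X = f X + lam * (\<Sum>i=1..n. loss01 (1 + A i \<bullet> X))"

definition active_set :: "nat \<Rightarrow> (nat \<Rightarrow> real^'p^'m) \<Rightarrow> real^'p^'m \<Rightarrow> nat set" where
  "active_set n A X = {i \<in> {1..n}. 1 + A i \<bullet> X = 0}"

text \<open>The second condition, on the inactive indices, imposes no restriction.\<close>

definition direction_cone ::
  "nat \<Rightarrow> (nat \<Rightarrow> real^'p^'m) \<Rightarrow> real^'p^'m \<Rightarrow> (real^'p^'m) set" where
  "direction_cone n A X =
     {D. (\<forall>i\<in>active_set n A X. D \<bullet> A i \<le> 0) \<and>
         (\<forall>i\<in>{1..n} - active_set n A X. D \<bullet> A i \<in> \<real>)}"

end

theory Submission
  imports Defs
begin

text \<open>
  The loss term only takes finitely many values, and near a point \<open>X\<close> it can change only through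
  the active indices. Moving from \<open>X\<close> to a nearby \<open>Y\<close> with \<open>Y - X\<close> in the cone \<open>C\<close> leaves every
  loss as it was; if \<open>Y - X\<close> lies outside \<open>C\<close>, some active loss jumps from 0 to 1 and the penalty
  rises by at least \<open>\<lambda>\<close>, which a continuous \<open>f\<close> cannot compensate close to \<open>X\<close>
  (\<open>eventually_loss_sum\<close>). Hence \<open>X\<close> is a local minimizer of the objective if and only if it is a
  local minimizer of \<open>f\<close> on \<open>X + C\<close> (\<open>local_minimizer_objective_iff\<close>).

  What remains is the first-order theory of a differentiable function on a closed cone with apex
  \<open>X\<close>: the derivative of \<open>f\<close> along a ray of the cone is nonnegative at a minimizer
  (\<open>first_order_necessary\<close>). Conversely, if the gradient is positive on all nonzero directions of
  the cone, compactness of the unit sphere gives a linear lower bound \<open>c * norm D\<close> with \<open>c > 0\<close>,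
  which dominates the error of the first-order expansion (\<open>first_order_sufficient\<close>).
\<close>

text \<open>
  The gradient is a definite description, so it needs both existence, by representing the
  derivative as an inner product in the standard basis, and uniqueness of derivatives.
\<close>

lemma has_derivative_gradient:
  fixes f :: "'a::euclidean_space \<Rightarrow> real"
  assumes "(f has_derivative f') (at X)"
  shows "(f has_derivative (\<lambda>h. gradient f X \<bullet> h)) (at X)"
proof -
  interpret linear f'
    using assms by (rule has_derivative_linear)
  let ?G = "\<Sum>b\<in>Basis. f' b *\<^sub>R b"
  have "f' h = h \<bullet> ?G" for h
  proof -
    have "f' h = f' (\<Sum>b\<in>Basis. (h \<bullet> b) *\<^sub>R b)"
      by (simp add: euclidean_representation)
    also have "\<dots> = h \<bullet> ?G"
      by (simp add: sum scale inner_sum_right mult.commute)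
    finally show ?thesis .
  qed
  with assms have G: "GDERIV f X :> ?G"
    by (metis (no_types, lifting) ext gderiv_def)
  have unique: "H = ?G" if "GDERIV f X :> H" for H
  proof (rule vector_eq_ldot[THEN iffD1, rule_format])
    fix h
    show "h \<bullet> H = h \<bullet> ?G"
      using has_derivative_unique that G unfolding gderiv_def by metis
  qed
  have "gradient f X = ?G"
    unfolding gradient_def using G unique by (rule the_equality)
  with G show ?thesis
    by (simp add: gderiv_def inner_commute)
qed

text \<open>
  Otherwise \<open>f\<close> would strictly decrease along a short initial piece of the ray in direction \<open>D\<close>.
\<close>

lemma first_order_necessary:
  fixes f :: "'a::real_inner \<Rightarrow> real"
  assumes f: "(f has_derivative (\<lambda>h. G \<bullet> h)) (at X)"
    and ray: "\<And>t. t > 0 \<Longrightarrow> t *\<^sub>R D \<in> C"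
    and min: "\<forall>\<^sub>F Y in nhds X. Y - X \<in> C \<longrightarrow> f X \<le> f Y"
  shows "G \<bullet> D \<ge> 0"
proof (rule ccontr)
  assume neg: "\<not> G \<bullet> D \<ge> 0"
  let ?g = "\<lambda>t. f (X + t *\<^sub>R D)"
  have "((\<lambda>t. X + t *\<^sub>R D) has_derivative (\<lambda>t. t *\<^sub>R D)) (at 0)"
    by (auto intro!: derivative_eq_intros)
  then have "(?g has_derivative (\<lambda>t. G \<bullet> (t *\<^sub>R D))) (at 0)"
    by (rule has_derivative_compose) (simp add: f)
  then have "DERIV ?g 0 :> G \<bullet> D"
    by (simp add: has_field_derivative_def mult.commute[of _ "G \<bullet> D"])
  from DERIV_neg_dec_right[OF this] neg
  obtain d where "d > 0" and d: "\<And>t. t > 0 \<Longrightarrow> t < d \<Longrightarrow> ?g t < ?g 0"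
    by (auto simp: not_le)
  have "((\<lambda>t. X + t *\<^sub>R D) \<longlongrightarrow> X + 0 *\<^sub>R D) (at_right 0)"
    by (intro tendsto_intros)
  then have "\<forall>\<^sub>F t in at_right 0. t *\<^sub>R D \<in> C \<longrightarrow> f X \<le> ?g t"
    using eventually_compose_filterlim[OF min, of "\<lambda>t. X + t *\<^sub>R D"] by simp
  moreover have "\<forall>\<^sub>F t in at_right 0. t > 0 \<and> t < d"
    using \<open>d > 0\<close> by (auto simp: eventually_at_right_field)
  ultimately have "\<forall>\<^sub>F t in at_right (0::real). False"
    by eventually_elim (use ray d in fastforce)
  then show False
    by (simp add: trivial_limit_at_right_real eventually_False)
qed

text \<open>
  Positivity at each direction is not enough by itself: the first-order error is only
  \<open>o(norm D)\<close> and must be beaten uniformly in the direction. The minimum \<open>c\<close> of \<open>G \<bullet> D\<close> over the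
  compact set of unit vectors of \<open>C\<close> provides the uniformity, and the error bound is applied with
  this \<open>c\<close>.
\<close>

lemma first_order_sufficient:
  fixes f :: "'a::euclidean_space \<Rightarrow> real"
  assumes f: "(f has_derivative (\<lambda>h. G \<bullet> h)) (at X)"
    and "closed C" and cone: "\<And>D t. D \<in> C \<Longrightarrow> t > 0 \<Longrightarrow> t *\<^sub>R D \<in> C"
    and pos: "\<And>D. D \<in> C \<Longrightarrow> D \<noteq> 0 \<Longrightarrow> G \<bullet> D > 0"
  shows "\<forall>\<^sub>F Y in nhds X. Y - X \<in> C \<longrightarrow> f X \<le> f Y"
proof -
  have "\<exists>c>0. \<forall>D\<in>C. c * norm D \<le> G \<bullet> D"
  proof (cases "C \<inter> sphere 0 1 = {}")
    case True
    have "D = 0" if "D \<in> C" for D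
    proof (rule ccontr)
      assume "D \<noteq> 0"
      with cone[OF that, of "1 / norm D"] True show False
        by (auto simp: disjoint_iff)
    qed
    \<comment> \<open>The cone is trivial, so any positive constant works.\<close>
    then have "\<forall>D\<in>C. 1 * norm D \<le> G \<bullet> D"
      by fastforce
    then show ?thesis
      using zero_less_one by blast
  next
    case False
    have "compact (C \<inter> sphere 0 1)"
      using \<open>closed C\<close> by (simp add: closed_Int_compact)
    from continuous_attains_inf[OF this False, of "\<lambda>D. G \<bullet> D"]
    obtain E where E: "E \<in> C" "norm E = 1"
      and min: "\<And>D. D \<in> C \<Longrightarrow> norm D = 1 \<Longrightarrow> G \<bullet> E \<le> G \<bullet> D"
      by (force intro: continuous_intros)
    have "G \<bullet> E * norm D \<le> G \<bullet> D" if "D \<in> C" for D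
    proof (cases "D = 0")
      case False
      then show ?thesis
        using min[OF cone[OF that, of "1 / norm D"]] by (simp add: field_simps)
    qed simp
    moreover have "G \<bullet> E > 0"
      using E pos by force
    ultimately show ?thesis
      by blast
  qed
  then obtain c where "c > 0" and c: "\<And>D. D \<in> C \<Longrightarrow> c * norm D \<le> G \<bullet> D"
    by blast
  obtain d where "d > 0"
    and d: "\<And>Y. norm (Y - X) < d \<Longrightarrow> norm (f Y - f X - G \<bullet> (Y - X)) \<le> c * norm (Y - X)"
    using f \<open>c > 0\<close> unfolding has_derivative_at_alt by blast
  have "f X \<le> f Y" if "dist Y X < d" "Y - X \<in> C" for Y
    using d[of Y] c[OF that(2)] that(1) by (simp add: dist_norm abs_le_iff)
  with \<open>d > 0\<close> show ?thesis
    unfolding eventually_nhds_metric by blast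
qed

lemma mem_direction_cone_iff:
  "D \<in> direction_cone n A X \<longleftrightarrow> (\<forall>i\<in>active_set n A X. A i \<bullet> D \<le> 0)"
  by (simp add: direction_cone_def inner_commute Reals_def)

lemma closed_direction_cone: "closed (direction_cone n A X)"
proof -
  have "direction_cone n A X = (\<Inter>i\<in>active_set n A X. {D. A i \<bullet> D \<le> 0})"
    by (auto simp: mem_direction_cone_iff)
  then show ?thesis
    by (simp add: closed_INT closed_halfspace_le)
qed

lemma scaleR_mem_direction_cone:
  "D \<in> direction_cone n A X \<Longrightarrow> t > 0 \<Longrightarrow> t *\<^sub>R D \<in> direction_cone n A X"
  by (simp add: mem_direction_cone_iff mult_nonneg_nonpos)

text \<open>A nonzero argument of the loss keeps its sign near \<open>X\<close>, so only active indices contribute.\<close>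

lemma eventually_loss01:
  fixes a X :: "'a::real_inner"
  shows "\<forall>\<^sub>F Y in nhds X. loss01 (1 + a \<bullet> Y) =
    loss01 (1 + a \<bullet> X) + (if 1 + a \<bullet> X = 0 \<and> a \<bullet> (Y - X) > 0 then 1 else 0)"
proof -
  have lim: "((\<lambda>Y. 1 + a \<bullet> Y) \<longlongrightarrow> 1 + a \<bullet> X) (nhds X)"
    by (intro tendsto_intros) (simp add: filterlim_ident)
  consider "1 + a \<bullet> X > 0" | "1 + a \<bullet> X < 0" | "1 + a \<bullet> X = 0"
    by linarith
  then show ?thesis
  proof cases
    case 1
    with order_tendstoD(1)[OF lim 1] show ?thesis
      by (auto elim!: eventually_mono simp: loss01_def)
  next
    case 2
    with order_tendstoD(2)[OF lim 2] show ?thesis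
      by (auto elim!: eventually_mono simp: loss01_def)
  next
    case 3
    then show ?thesis
      by (auto simp: loss01_def inner_diff_right)
  qed
qed

text \<open>
  Writing the excess as a cardinality makes the jump visible: it is a natural number, so it is at
  least 1 as soon as \<open>Y - X\<close> leaves the cone.
\<close>

lemma eventually_loss_sum:
  "\<forall>\<^sub>F Y in nhds X.
     (\<Sum>i=1..n. loss01 (1 + A i \<bullet> Y)) =
     (\<Sum>i=1..n. loss01 (1 + A i \<bullet> X)) + card {i \<in> active_set n A X. A i \<bullet> (Y - X) > 0}"
proof -
  have "\<forall>\<^sub>F Y in nhds X. \<forall>i\<in>{1..n}. loss01 (1 + A i \<bullet> Y) =
    loss01 (1 + A i \<bullet> X) + (if 1 + A i \<bullet> X = 0 \<and> A i \<bullet> (Y - X) > 0 then 1 else 0)"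
    by (intro eventually_ball_finite ballI eventually_loss01) simp
  then show ?thesis
  proof eventually_elim
    case (elim Y)
    have "{i \<in> active_set n A X. A i \<bullet> (Y - X) > 0} =
      {i \<in> {1..n}. 1 + A i \<bullet> X = 0 \<and> A i \<bullet> (Y - X) > 0}"
      by (auto simp: active_set_def)
    with elim show ?case
      by (simp add: sum.distrib flip: sum.inter_filter)
  qed
qed

lemma local_minimizer_iff_eventually:
  "local_minimizer F X \<longleftrightarrow> (\<forall>\<^sub>F Y in nhds X. F X \<le> F Y)"
  by (simp add: local_minimizer_def eventually_nhds_metric dist_norm)

text \<open>
  Leaving the cone costs at least \<open>lam\<close>, while continuity keeps the possible decrease of \<open>f\<close>
  below \<open>lam\<close>; staying in it costs nothing.
\<close>

lemma local_minimizer_objective_iff: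
  assumes "isCont f X" and "lam > 0"
  shows "local_minimizer (objective f lam n A) X \<longleftrightarrow>
    (\<forall>\<^sub>F Y in nhds X. Y - X \<in> direction_cone n A X \<longrightarrow> f X \<le> f Y)"
  unfolding local_minimizer_iff_eventually
proof (rule eventually_subst)
  have "(f \<longlongrightarrow> f X) (nhds X)"
    using \<open>isCont f X\<close> by (simp add: isCont_def tendsto_nhds_iff)
  then have "\<forall>\<^sub>F Y in nhds X. f X - lam < f Y"
    by (rule order_tendstoD) (use \<open>lam > 0\<close> in simp)
  then show "\<forall>\<^sub>F Y in nhds X. objective f lam n A X \<le> objective f lam n A Y \<longleftrightarrow>
    (Y - X \<in> direction_cone n A X \<longrightarrow> f X \<le> f Y)"
    using eventually_loss_sum[where A = A and n = n and X = X]
  proof eventually_elim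
    case (elim Y)
    let ?V = "{i \<in> active_set n A X. A i \<bullet> (Y - X) > 0}"
    have diff: "objective f lam n A Y = objective f lam n A X + (f Y - f X) + lam * card ?V"
      using elim(2) by (simp add: objective_def algebra_simps)
    show ?case
    proof (cases "Y - X \<in> direction_cone n A X")
      case True
      then have "?V = {}"
        by (auto simp: mem_direction_cone_iff not_less)
      with diff True show ?thesis
        by simp
    next
      case False
      then have "?V \<noteq> {}"
        by (auto simp: mem_direction_cone_iff not_le)
      moreover have "finite ?V"
        by (simp add: active_set_def)
      ultimately have "1 \<le> card ?V"
        by (simp add: Suc_le_eq card_gt_0_iff)
      then have "lam \<le> lam * card ?V"
        using \<open>lam > 0\<close> by simp
      with diff elim(1) False show ?thesis
        by simp
    qed
  qed
qed

theorem mainTheorem1: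
  fixes f :: "real^'p^'m \<Rightarrow> real"
    and A :: "nat \<Rightarrow> real^'p^'m"
    and n :: nat
    and lam :: real
    and Xstar :: "real^'p^'m"
  assumes n_pos: "n \<ge> 1"
    and f_C2: "twice_cont_diff f"
    and lam_pos: "lam > 0"
    and pos_indep: "\<And>z :: nat \<Rightarrow> real.
          \<forall>i\<in>active_set n A Xstar. z i \<ge> 0 \<Longrightarrow>
          (\<Sum>i\<in>active_set n A Xstar. z i *\<^sub>R A i) = 0 \<Longrightarrow>
          \<forall>i\<in>active_set n A Xstar. z i = 0"
  shows "(local_minimizer (objective f lam n A) Xstar \<longrightarrow>
            (\<forall>D\<in>direction_cone n A Xstar. gradient f Xstar \<bullet> D \<ge> 0)) \<and>
         ((\<forall>D\<in>direction_cone n A Xstar - {0}. gradient f Xstar \<bullet> D > 0) \<longrightarrow>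
            local_minimizer (objective f lam n A) Xstar)"
proof -
  obtain f' where "(f has_derivative f') (at Xstar)"
    using f_C2 unfolding twice_cont_diff_def by blast
  then have grad: "(f has_derivative (\<lambda>h. gradient f Xstar \<bullet> h)) (at Xstar)"
    by (rule has_derivative_gradient)
  note min_iff = local_minimizer_objective_iff[OF has_derivative_continuous[OF grad] lam_pos]
  show ?thesis
    unfolding min_iff
    using first_order_necessary[OF grad scaleR_mem_direction_cone]
      first_order_sufficient[OF grad closed_direction_cone scaleR_mem_direction_cone]
    by blast
qed

end
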